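(* Let $\Lambda\subset H_3$ be a lattice and let $M=\Lambda\backslash H_3$ be the corresponding compact Heisenberg nilmanifold, with the metric $g$ induced by the canonical metric of $H_3$. An invariant magnetic field $\omega_F$ on $M$ has finite Mañé critical value $c(g,\omega_F)$ if and only if $\omega_F=\rho\,e^1\wedge e^2$ for some $\rho\in\mathbb{R}$. In this case $\omega_F$ is invariant exact (it has a left-invariant primitive) and $c(g,\omega_F)=\frac{\rho^2}{2}$.
   Context: The Heisenberg group $H_3$ is $\mathbb{R}^3$ with product $(x_1,y_1,z_1)(x_2,y_2,z_2)=(x_1+x_2,\,y_1+y_2,\,z_1+z_2+\tfrac12(x_1y_2-x_2y_1))$. Its Lie algebra has basis of left-invariant fields $e_1=\partial_x-\tfrac12 y\,\partial_z$, $e_2=\partial_y+\tfrac12 x\,\partial_z$, $e_3=\partial_z$, with $[e_1,e_2]=e_3$; $e^1,e^2,e^3$ is the dual basis of left-invariant 1-forms. The canonical metric is the left-invariant metric for which $e_1,e_2,e_3$ is orthonormal. A lattice is a discrete cocompact subgroup. An invariant magnetic field on $M$ is a closed 2-form on $M$ whose pullback to $H_3$ is left-invariant; it is identified with that pullback. Mañé critical value: if $\widetilde\omega$ is the pullback of $\omega$ to the universal cover $\widetilde M$ and $\widetilde\omega$ is exact, then $c(g,\omega)=\inf_{\theta:\,d\theta=\widetilde\omega}\ \sup_{p\in\widetilde M}\tfrac12|\theta_p|^2\in[0,\infty]$, the infimum being over smooth 1-forms $\theta$ on $\widetilde M$, with $|\cdot|$ the norm induced by the metric. *)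

theory Defs
  imports "HOL-Analysis.Analysis" "HOL-Algebra.Coset"
begin

section \<open>The Heisenberg group\<close>

definition heis_mult :: "real^3 \<Rightarrow> real^3 \<Rightarrow> real^3" where
  "heis_mult p q =
     vector [p$1 + q$1, p$2 + q$2, p$3 + q$3 + (1/2) * (p$1 * q$2 - q$1 * p$2)]"

definition heis_group :: "(real^3) monoid" where
  "heis_group = \<lparr>carrier = UNIV, monoid.mult = heis_mult, one = 0\<rparr>"

lemma heis_mult_nth [simp]:
  "heis_mult p q $ 1 = p$1 + q$1"
  "heis_mult p q $ 2 = p$2 + q$2"
  "heis_mult p q $ 3 = p$3 + q$3 + (1/2) * (p$1 * q$2 - q$1 * p$2)"
  by (simp_all add: heis_mult_def)

lemma heis_group_simps [simp]:
  "carrier heis_group = UNIV" "monoid.mult heis_group = heis_mult" "one heis_group = 0"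
  by (simp_all add: heis_group_def)

lemma heis_mult_assoc: "heis_mult (heis_mult p q) r = heis_mult p (heis_mult q r)"
  by (simp add: vec_eq_iff forall_3 algebra_simps add_divide_distrib diff_divide_distrib)

lemma heis_mult_right_cancel: "heis_mult a p = heis_mult b p \<longleftrightarrow> a = b"
  by (auto simp: vec_eq_iff forall_3)

lemma group_heis_group: "Group.group heis_group"
proof (rule groupI)
  fix x assume "x \<in> carrier heis_group"
  show "\<exists>y\<in>carrier heis_group. y \<otimes>\<^bsub>heis_group\<^esub> x = \<one>\<^bsub>heis_group\<^esub>"
    by (rule bexI[of _ "- x"]) (simp_all add: vec_eq_iff forall_3)
qed (simp_all add: heis_mult_assoc, simp add: vec_eq_iff forall_3)

text \<open>Left-invariant frame, and its dual coframe.\<close>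

definition heis_e1 :: "real^3 \<Rightarrow> real^3" where "heis_e1 p = vector [1, 0, - (1/2) * p$2]"
definition heis_e2 :: "real^3 \<Rightarrow> real^3" where "heis_e2 p = vector [0, 1, (1/2) * p$1]"
definition heis_e3 :: "real^3 \<Rightarrow> real^3" where "heis_e3 p = vector [0, 0, 1]"

definition heis_f1 :: "real^3 \<Rightarrow> real^3 \<Rightarrow> real" where "heis_f1 p v = v$1"
definition heis_f2 :: "real^3 \<Rightarrow> real^3 \<Rightarrow> real" where "heis_f2 p v = v$2"
definition heis_f3 :: "real^3 \<Rightarrow> real^3 \<Rightarrow> real" where
  "heis_f3 p v = v$3 - (1/2) * (p$1 * v$2 - p$2 * v$1)"

lemma heis_dual_basis:
  "heis_f1 p (heis_e1 p) = 1" "heis_f1 p (heis_e2 p) = 0" "heis_f1 p (heis_e3 p) = 0"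
  "heis_f2 p (heis_e1 p) = 0" "heis_f2 p (heis_e2 p) = 1" "heis_f2 p (heis_e3 p) = 0"
  "heis_f3 p (heis_e1 p) = 0" "heis_f3 p (heis_e2 p) = 0" "heis_f3 p (heis_e3 p) = 1"
  by (simp_all add: heis_f1_def heis_f2_def heis_f3_def heis_e1_def heis_e2_def heis_e3_def)


section \<open>Tensor fields and differential forms on a Euclidean space\<close>

text \<open>
  A covariant tensor field is a function of the base point and of tangent vectors there; all
  tangent spaces are identified with the ambient vector space.
\<close>

fun C_k :: "nat \<Rightarrow> ('a::real_normed_vector \<Rightarrow> 'b::real_normed_vector) \<Rightarrow> bool" where
  "C_k 0 f \<longleftrightarrow> continuous_on UNIV f"
| "C_k (Suc k) f \<longleftrightarrow>
     (\<forall>x. f differentiable (at x)) \<and> (\<forall>v. C_k k (\<lambda>x. frechet_derivative f (at x) v))"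

definition C_infinity :: "('a::real_normed_vector \<Rightarrow> 'b::real_normed_vector) \<Rightarrow> bool" where
  "C_infinity f \<longleftrightarrow> (\<forall>k. C_k k f)"

definition smooth_1form :: "('a::euclidean_space \<Rightarrow> 'a \<Rightarrow> real) \<Rightarrow> bool" where
  "smooth_1form \<theta> \<longleftrightarrow> (\<forall>p. linear (\<theta> p)) \<and> (\<forall>v. C_infinity (\<lambda>p. \<theta> p v))"

definition smooth_2form :: "('a::euclidean_space \<Rightarrow> 'a \<Rightarrow> 'a \<Rightarrow> real) \<Rightarrow> bool" where
  "smooth_2form \<omega> \<longleftrightarrow>
     (\<forall>p. bilinear (\<omega> p)) \<and> (\<forall>p v. \<omega> p v v = 0) \<and> (\<forall>u v. C_infinity (\<lambda>p. \<omega> p u v))"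

text \<open>
  Exterior derivatives, by the invariant formula evaluated on constant (hence commuting) vector
  fields; no factor 1/2 or 1/3, in accordance with the convention for the wedge product below.
\<close>

definition ext_d1 :: "('a::euclidean_space \<Rightarrow> 'a \<Rightarrow> real) \<Rightarrow> 'a \<Rightarrow> 'a \<Rightarrow> 'a \<Rightarrow> real" where
  "ext_d1 \<theta> p u v =
     frechet_derivative (\<lambda>q. \<theta> q v) (at p) u - frechet_derivative (\<lambda>q. \<theta> q u) (at p) v"

definition ext_d2 ::
  "('a::euclidean_space \<Rightarrow> 'a \<Rightarrow> 'a \<Rightarrow> real) \<Rightarrow> 'a \<Rightarrow> 'a \<Rightarrow> 'a \<Rightarrow> 'a \<Rightarrow> real" where
  "ext_d2 \<omega> p u v w =
     frechet_derivative (\<lambda>q. \<omega> q v w) (at p) u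
     - frechet_derivative (\<lambda>q. \<omega> q u w) (at p) v
     + frechet_derivative (\<lambda>q. \<omega> q u v) (at p) w"

definition wedge11 ::
  "('a \<Rightarrow> 'a \<Rightarrow> real) \<Rightarrow> ('a \<Rightarrow> 'a \<Rightarrow> real) \<Rightarrow> 'a \<Rightarrow> 'a \<Rightarrow> 'a \<Rightarrow> real" where
  "wedge11 \<alpha> \<beta> p u v = \<alpha> p u * \<beta> p v - \<alpha> p v * \<beta> p u"

definition pull_back1 ::
  "('a::euclidean_space \<Rightarrow> 'a) \<Rightarrow> ('a \<Rightarrow> 'a \<Rightarrow> real) \<Rightarrow> 'a \<Rightarrow> 'a \<Rightarrow> real" where
  "pull_back1 f \<theta> p v = \<theta> (f p) (frechet_derivative f (at p) v)"

definition pull_back2 ::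
  "('a::euclidean_space \<Rightarrow> 'a) \<Rightarrow> ('a \<Rightarrow> 'a \<Rightarrow> 'a \<Rightarrow> real) \<Rightarrow> 'a \<Rightarrow> 'a \<Rightarrow> 'a \<Rightarrow> real" where
  "pull_back2 f B p u v =
     B (f p) (frechet_derivative f (at p) u) (frechet_derivative f (at p) v)"

text \<open>Norm on the cotangent space dual to the norm on the tangent space given by \<open>b\<close>.\<close>

definition dual_norm ::
  "('a::euclidean_space \<Rightarrow> 'a \<Rightarrow> real) \<Rightarrow> ('a \<Rightarrow> real) \<Rightarrow> real" where
  "dual_norm b \<alpha> = Sup {\<bar>\<alpha> v\<bar> | v. b v v \<le> 1}"


section \<open>Left-invariant tensor fields on the Heisenberg group\<close>

definition left_invariant1 :: "(real^3 \<Rightarrow> real^3 \<Rightarrow> real) \<Rightarrow> bool" where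
  "left_invariant1 \<theta> \<longleftrightarrow> (\<forall>a. pull_back1 (heis_mult a) \<theta> = \<theta>)"

definition left_invariant2 :: "(real^3 \<Rightarrow> real^3 \<Rightarrow> real^3 \<Rightarrow> real) \<Rightarrow> bool" where
  "left_invariant2 B \<longleftrightarrow> (\<forall>a. pull_back2 (heis_mult a) B = B)"

definition heis_metric :: "real^3 \<Rightarrow> real^3 \<Rightarrow> real^3 \<Rightarrow> real" where
  "heis_metric p u v =
     heis_f1 p u * heis_f1 p v + heis_f2 p u * heis_f2 p v + heis_f3 p u * heis_f3 p v"

lemma heis_metric_orthonormal:
  "heis_metric p (heis_e1 p) (heis_e1 p) = 1" "heis_metric p (heis_e1 p) (heis_e2 p) = 0"
  "heis_metric p (heis_e1 p) (heis_e3 p) = 0" "heis_metric p (heis_e2 p) (heis_e2 p) = 1"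
  "heis_metric p (heis_e2 p) (heis_e3 p) = 0" "heis_metric p (heis_e3 p) (heis_e3 p) = 1"
  by (simp_all add: heis_metric_def heis_dual_basis)

lemma heis_mult_has_derivative:
  "(heis_mult a has_derivative
     (\<lambda>v. vector [v$1, v$2, v$3 + (1/2) * (a$1 * v$2 - v$1 * a$2)])) (at p)"
proof -
  define D :: "real^3 \<Rightarrow> real^3"
    where "D = (\<lambda>v. vector [v$1, v$2, v$3 + (1/2) * (a$1 * v$2 - v$1 * a$2)])"
  have "linear D"
    by (rule linearI) (simp_all add: D_def vec_eq_iff forall_3 algebra_simps add_divide_distrib diff_divide_distrib)
  then have "bounded_linear D"
    by (simp add: linear_conv_bounded_linear)
  then have "((\<lambda>q. a + D q) has_derivative D) (at p)"
    using has_derivative_add[OF has_derivative_const bounded_linear_imp_has_derivative] by simp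
  moreover have "heis_mult a = (\<lambda>q. a + D q)"
    by (auto simp: fun_eq_iff D_def vec_eq_iff forall_3)
  ultimately show ?thesis
    by (simp add: D_def)
qed

lemma frechet_derivative_heis_mult:
  "frechet_derivative (heis_mult a) (at p) v =
     vector [v$1, v$2, v$3 + (1/2) * (a$1 * v$2 - v$1 * a$2)]"
  by (simp add: frechet_derivative_at[OF heis_mult_has_derivative[of a p], symmetric])

lemma left_invariant_frame:
  "frechet_derivative (heis_mult a) (at p) (heis_e1 p) = heis_e1 (heis_mult a p)"
  "frechet_derivative (heis_mult a) (at p) (heis_e2 p) = heis_e2 (heis_mult a p)"
  "frechet_derivative (heis_mult a) (at p) (heis_e3 p) = heis_e3 (heis_mult a p)"
  by (simp_all add: frechet_derivative_heis_mult heis_e1_def heis_e2_def heis_e3_def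
      vec_eq_iff forall_3 algebra_simps add_divide_distrib diff_divide_distrib)

lemma left_invariant_coframe:
  "left_invariant1 heis_f1" "left_invariant1 heis_f2" "left_invariant1 heis_f3"
  by (simp_all add: left_invariant1_def pull_back1_def fun_eq_iff frechet_derivative_heis_mult
      heis_f1_def heis_f2_def heis_f3_def algebra_simps add_divide_distrib diff_divide_distrib)

lemma left_invariant_heis_metric: "left_invariant2 heis_metric"
  by (simp add: left_invariant2_def pull_back2_def fun_eq_iff frechet_derivative_heis_mult
      heis_metric_def heis_f1_def heis_f2_def heis_f3_def algebra_simps)


section \<open>Compact Heisenberg nilmanifolds\<close>

text \<open>
  The points of \<open>M = \<Lambda>\H\<^sub>3\<close> are the cosets \<open>\<Lambda>p\<close>, which HOL-Algebra calls right cosets.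
\<close>

definition nilmanifold_topology :: "(real^3) set \<Rightarrow> (real^3) set topology" where
  "nilmanifold_topology \<Lambda> =
     topology (\<lambda>U. U \<subseteq> rcosets\<^bsub>heis_group\<^esub> \<Lambda> \<and> open {p. \<Lambda> #>\<^bsub>heis_group\<^esub> p \<in> U})"

lemma openin_nilmanifold_topology:
  "openin (nilmanifold_topology \<Lambda>) U \<longleftrightarrow>
     U \<subseteq> rcosets\<^bsub>heis_group\<^esub> \<Lambda> \<and> open {p. \<Lambda> #>\<^bsub>heis_group\<^esub> p \<in> U}"
proof -
  let ?P = "\<lambda>U. U \<subseteq> rcosets\<^bsub>heis_group\<^esub> \<Lambda> \<and> open {p. \<Lambda> #>\<^bsub>heis_group\<^esub> p \<in> U}"
  have "istopology ?P"
    unfolding istopology_def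
  proof (intro conjI allI impI)
    fix S T assume "?P S" "?P T"
    then show "S \<inter> T \<subseteq> rcosets\<^bsub>heis_group\<^esub> \<Lambda>" "open {p. \<Lambda> #>\<^bsub>heis_group\<^esub> p \<in> S \<inter> T}"
      using open_Collect_conj[of "\<lambda>p. \<Lambda> #>\<^bsub>heis_group\<^esub> p \<in> S" "\<lambda>p. \<Lambda> #>\<^bsub>heis_group\<^esub> p \<in> T"]
      by auto
  next
    fix \<K> assume K: "\<forall>U\<in>\<K>. ?P U"
    then show "\<Union> \<K> \<subseteq> rcosets\<^bsub>heis_group\<^esub> \<Lambda>"
      by auto
    have "{p. \<Lambda> #>\<^bsub>heis_group\<^esub> p \<in> \<Union> \<K>} = (\<Union>U\<in>\<K>. {p. \<Lambda> #>\<^bsub>heis_group\<^esub> p \<in> U})"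
      by auto
    with K show "open {p. \<Lambda> #>\<^bsub>heis_group\<^esub> p \<in> \<Union> \<K>}"
      by auto
  qed
  then show ?thesis
    by (simp add: nilmanifold_topology_def topology_inverse')
qed

lemma quotient_map_nilmanifold:
  "quotient_map euclidean (nilmanifold_topology \<Lambda>) (\<lambda>p. \<Lambda> #>\<^bsub>heis_group\<^esub> p)"
proof -
  have rcosets: "\<Lambda> #>\<^bsub>heis_group\<^esub> p \<in> rcosets\<^bsub>heis_group\<^esub> \<Lambda>" for p
    by (auto simp: RCOSETS_def)
  then have "openin (nilmanifold_topology \<Lambda>) (rcosets\<^bsub>heis_group\<^esub> \<Lambda>)"
    using open_UNIV by (simp add: openin_nilmanifold_topology rcosets)
  then have "topspace (nilmanifold_topology \<Lambda>) = rcosets\<^bsub>heis_group\<^esub> \<Lambda>"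
    by (meson openin_nilmanifold_topology openin_subset openin_topspace subset_antisym)
  then show ?thesis
    by (auto simp: quotient_map_def openin_nilmanifold_topology RCOSETS_def)
qed

definition heis_lattice :: "(real^3) set \<Rightarrow> bool" where
  "heis_lattice \<Lambda> \<longleftrightarrow>
     subgroup \<Lambda> heis_group \<and> discrete \<Lambda> \<and> compact_space (nilmanifold_topology \<Lambda>)"

text \<open>
  Since \<open>\<Lambda>\<close> acts freely and properly discontinuously by left translations, the tangent bundle of
  \<open>M\<close> is the quotient of the tangent bundle of \<open>H\<^sub>3\<close> by the induced action: a tangent vector to
  \<open>M\<close> is an orbit, and \<open>tangent_proj \<Lambda> p v\<close> is the image of \<open>v\<close>, tangent at \<open>p\<close>, under the
  differential of the projection \<open>H\<^sub>3 \<rightarrow> M\<close>.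
  The projection is a local diffeomorphism (and the universal covering of \<open>M\<close>), so the linear and
  the smooth structure on \<open>M\<close> are those inherited through it.  A 2-tensor field on \<open>M\<close> is a function
  of two tangent vectors to \<open>M\<close> with a common base point (its values elsewhere are never used), and
  \<open>lift2\<close> is its pullback to \<open>H\<^sub>3\<close>.
\<close>

type_synonym nil_tangent = "((real^3) \<times> (real^3)) set"

definition tangent_proj :: "(real^3) set \<Rightarrow> real^3 \<Rightarrow> real^3 \<Rightarrow> nil_tangent" where
  "tangent_proj \<Lambda> p v = {(heis_mult a p, frechet_derivative (heis_mult a) (at p) v) | a. a \<in> \<Lambda>}"

definition lift2 ::
  "(real^3) set \<Rightarrow> (nil_tangent \<Rightarrow> nil_tangent \<Rightarrow> real) \<Rightarrow> real^3 \<Rightarrow> real^3 \<Rightarrow> real^3 \<Rightarrow> real" where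
  "lift2 \<Lambda> B p u v = B (tangent_proj \<Lambda> p u) (tangent_proj \<Lambda> p v)"

text \<open>The 2-tensor field on \<open>M\<close> induced by a \<open>\<Lambda>\<close>-invariant one on \<open>H\<^sub>3\<close>.\<close>

definition descend2 ::
  "(real^3) set \<Rightarrow> (real^3 \<Rightarrow> real^3 \<Rightarrow> real^3 \<Rightarrow> real) \<Rightarrow> nil_tangent \<Rightarrow> nil_tangent \<Rightarrow> real" where
  "descend2 \<Lambda> B X Y =
     (THE r. \<exists>p u v. X = tangent_proj \<Lambda> p u \<and> Y = tangent_proj \<Lambda> p v \<and> r = B p u v)"

lemma lift2_descend2:
  assumes \<Lambda>: "subgroup \<Lambda> heis_group"
    and inv: "\<And>a. a \<in> \<Lambda> \<Longrightarrow> pull_back2 (heis_mult a) B = B"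
  shows "lift2 \<Lambda> (descend2 \<Lambda> B) = B"
proof (intro ext)
  fix p u v
  have zero: "0 \<in> \<Lambda>"
    using subgroup.one_closed[OF \<Lambda>] by simp
  have mem: "(q, w) \<in> tangent_proj \<Lambda> q w" for q w
  proof -
    have "heis_mult 0 q = q" "frechet_derivative (heis_mult 0) (at q) w = w"
      by (simp_all add: frechet_derivative_heis_mult vec_eq_iff forall_3)
    then show ?thesis
      using zero unfolding tangent_proj_def by (metis (mono_tags, lifting) mem_Collect_eq)
  qed
  have "r = B p u v"
    if eqs: "tangent_proj \<Lambda> p u = tangent_proj \<Lambda> p' u'" "tangent_proj \<Lambda> p v = tangent_proj \<Lambda> p' v'"
      "r = B p' u' v'" for r p' u' v'
  proof -
    obtain a where a: "a \<in> \<Lambda>" "p' = heis_mult a p"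
      "u' = frechet_derivative (heis_mult a) (at p) u"
      using mem[of p' u'] unfolding eqs(1)[symmetric] by (auto simp: tangent_proj_def)
    obtain b where b: "b \<in> \<Lambda>" "p' = heis_mult b p"
      "v' = frechet_derivative (heis_mult b) (at p) v"
      using mem[of p' v'] unfolding eqs(2)[symmetric] by (auto simp: tangent_proj_def)
    have "b = a"
      using a(2) b(2) by (metis heis_mult_right_cancel)
    then have "B p' u' v' = pull_back2 (heis_mult a) B p u v"
      using a b by (simp add: pull_back2_def)
    with inv[OF a(1)] eqs(3) show ?thesis
      by simp
  qed
  then show "lift2 \<Lambda> (descend2 \<Lambda> B) p u v = B p u v"
    unfolding lift2_def descend2_def by (intro the_equality) blast+
qed

definition nil_metric :: "(real^3) set \<Rightarrow> nil_tangent \<Rightarrow> nil_tangent \<Rightarrow> real" where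
  "nil_metric \<Lambda> = descend2 \<Lambda> heis_metric"

definition magnetic_field :: "(real^3) set \<Rightarrow> (nil_tangent \<Rightarrow> nil_tangent \<Rightarrow> real) \<Rightarrow> bool" where
  "magnetic_field \<Lambda> \<omega> \<longleftrightarrow>
     smooth_2form (lift2 \<Lambda> \<omega>) \<and> ext_d2 (lift2 \<Lambda> \<omega>) = (\<lambda>p u v w. 0)"

definition invariant_magnetic_field ::
  "(real^3) set \<Rightarrow> (nil_tangent \<Rightarrow> nil_tangent \<Rightarrow> real) \<Rightarrow> bool" where
  "invariant_magnetic_field \<Lambda> \<omega> \<longleftrightarrow> magnetic_field \<Lambda> \<omega> \<and> left_invariant2 (lift2 \<Lambda> \<omega>)"

text \<open>The infimum over the empty set being \<open>\<infinity>\<close>, a field whose lift is not exact gets the value \<open>\<infinity>\<close>.\<close>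

definition mane_critical_value ::
  "(real^3) set \<Rightarrow> (nil_tangent \<Rightarrow> nil_tangent \<Rightarrow> real) \<Rightarrow>
     (nil_tangent \<Rightarrow> nil_tangent \<Rightarrow> real) \<Rightarrow> ereal" where
  "mane_critical_value \<Lambda> g \<omega> =
     (INF \<theta>\<in>{\<theta>. smooth_1form \<theta> \<and> ext_d1 \<theta> = lift2 \<Lambda> \<omega>}.
        SUP p. ereal ((1/2) * (dual_norm (lift2 \<Lambda> g p) (\<theta> p))\<^sup>2))"

end

theory Submission
  imports Defs
begin

text \<open>
  A left-invariant 2-form is \<open>a e\<^sup>1 \<and> e\<^sup>2 + b e\<^sup>1 \<and> e\<^sup>3 + c e\<^sup>2 \<and> e\<^sup>3\<close>, and it has an explicit primitive
  \<open>\<eta>\<close>. Any primitive \<open>\<theta>\<close> differs from \<open>\<eta>\<close> by some \<open>df\<close>, whose increments around a loop add up to zero.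
  If \<open>\<bar>\<theta>\<bar> \<le> C\<close>, the flux of the form through the loop is therefore at most \<open>C\<close> times the length.
  Squares spanned by \<open>e\<^sub>1, e\<^sub>3\<close> and by \<open>e\<^sub>2, e\<^sub>3\<close> have flux \<open>b s\<^sup>2\<close> and \<open>c s\<^sup>2\<close> but length \<open>4 s\<close>, so
  \<open>b = c = 0\<close>. The horizontal lift of a planar square of side \<open>s\<close> ends at height \<open>s\<^sup>2\<close>; closed up by a
  vertical segment it has flux \<open>a s\<^sup>2\<close> and length \<open>4 s + s\<^sup>2\<close>, so \<open>\<bar>a\<bar> \<le> C\<close>, with equality for
  \<open>\<theta> = -a e\<^sup>3\<close>. Along straight segments the mean value theorem replaces integration.
\<close>

section \<open>Potentials of closed 1-forms and their increments along segments\<close>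

text \<open>Poincare lemma: the potential is the radial integral of \<alpha> at
  \<open>t *\<^sub>R x\<close> applied to \<open>x\<close>, over t in [0, 1]. Differentiating under
  the integral sign and using closedness turns the integrand into an exact t-derivative.\<close>

lemma closed_1form_potential:
  fixes \<alpha> :: "'a::euclidean_space \<Rightarrow> 'a \<Rightarrow> real"
  assumes lin: "\<And>p. linear (\<alpha> p)"
    and deriv: "\<And>v p. ((\<lambda>q. \<alpha> q v) has_derivative D v p) (at p)"
    and cont: "\<And>u v. continuous_on UNIV (\<lambda>p. D v p u)"
    and closed: "\<And>p u v. D v p u = D u p v"
  obtains f :: "'a \<Rightarrow> real"
  where "\<And>p v. ((\<lambda>s. f (p + s *\<^sub>R v)) has_real_derivative \<alpha> p v) (at 0)"
proof
  fix p v :: 'a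
  define F where "F = (\<lambda>s t. \<alpha> (t *\<^sub>R (p + s *\<^sub>R v)) (p + s *\<^sub>R v))"
  \<comment> \<open>The s-derivative of \<open>F\<close>. Both arguments of \<alpha> move with s, so
    \<alpha> is expanded over \<open>Basis\<close>: each summand is a coordinate times \<alpha> on a
    fixed vector, and the product rule applies.\<close>
  define F' where "F' = (\<lambda>s t. \<Sum>b\<in>Basis. (v \<bullet> b) * \<alpha> (t *\<^sub>R (p + s *\<^sub>R v)) b
      + ((p + s *\<^sub>R v) \<bullet> b) * (t * D b (t *\<^sub>R (p + s *\<^sub>R v)) v))"
  have expand: "\<alpha> q w = (\<Sum>b\<in>Basis. (w \<bullet> b) * \<alpha> q b)" for q w
    using linear_sum[OF lin, of q "\<lambda>b. (w \<bullet> b) *\<^sub>R b" Basis]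
    by (simp add: euclidean_representation linear_cmul[OF lin])
  have D_lin: "linear (D w q)" for w q
    using has_derivative_linear[OF deriv] .
  \<comment> \<open>Linearity in the vector fed to \<alpha> comes from closedness, which swaps it
    with the direction of differentiation.\<close>
  have D_expand: "D w q u = (\<Sum>b\<in>Basis. (w \<bullet> b) * D b q u)" for w q u
  proof -
    have "D w q u = D u q (\<Sum>b\<in>Basis. (w \<bullet> b) *\<^sub>R b)"
      by (simp add: closed[of w] euclidean_representation)
    also have "\<dots> = (\<Sum>b\<in>Basis. (w \<bullet> b) * D b q u)"
      by (simp add: linear_sum[OF D_lin] linear_cmul[OF D_lin] closed[of u])
    finally show ?thesis .
  qed
  have cont_\<alpha>: "continuous_on UNIV (\<lambda>q. \<alpha> q w)" for w
    using deriv by (meson continuous_at_imp_continuous_on has_derivative_continuous)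
  have F_deriv: "((\<lambda>s. F s t) has_real_derivative F' s t) (at s within UNIV)" for s t
  proof -
    have *: "((\<lambda>s. \<alpha> (t *\<^sub>R (p + s *\<^sub>R v)) b) has_real_derivative
        t * D b (t *\<^sub>R (p + s *\<^sub>R v)) v) (at s)" for b
    proof -
      have "((\<lambda>s. \<alpha> (t *\<^sub>R (p + s *\<^sub>R v)) b) has_derivative
          (\<lambda>h. D b (t *\<^sub>R (p + s *\<^sub>R v)) (t *\<^sub>R (h *\<^sub>R v)))) (at s)"
        by (rule has_derivative_compose[OF _ deriv]) (auto intro!: derivative_eq_intros)
      then show ?thesis
        by (rule has_derivative_imp_has_field_derivative) (simp add: linear_cmul[OF D_lin])
    qed
    have "((\<lambda>s. \<Sum>b\<in>Basis. ((p + s *\<^sub>R v) \<bullet> b) * \<alpha> (t *\<^sub>R (p + s *\<^sub>R v)) b)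
        has_real_derivative F' s t) (at s)"
      unfolding F'_def
      by (rule DERIV_sum) (auto intro!: derivative_eq_intros * simp: inner_add_left)
    then show ?thesis
      unfolding F_def by (subst expand) simp
  qed
  have F_cont: "continuous_on UNIV (F s)" for s
    unfolding F_def
    by (rule continuous_on_compose2[OF cont_\<alpha>]) (auto intro!: continuous_intros)
  have "((\<lambda>s. integral (cbox 0 1) (F s)) has_real_derivative integral (cbox 0 1) (F' 0))
      (at 0 within UNIV)"
  proof (rule leibniz_rule_field_derivative[OF F_deriv])
    show "F s integrable_on cbox 0 1" for s
      using F_cont continuous_on_subset integrable_continuous by blast
    have "continuous_on (UNIV \<times> cbox 0 1) (\<lambda>z. F' (fst z) (snd z))"
      unfolding F'_def
      by (intro continuous_intros continuous_on_compose2[OF cont_\<alpha>]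
          continuous_on_compose2[OF cont]) auto
    then show "continuous_on (UNIV \<times> cbox 0 1) (\<lambda>(s, t). F' s t)"
      by (simp add: case_prod_unfold)
  qed auto
  moreover have "integral (cbox 0 1) (F' 0) = \<alpha> p v"
  proof -
    \<comment> \<open>By closedness the integrand is the derivative of \<open>t \<mapsto> t \<alpha>\<^bsub>tp\<^esub>(v)\<close>.\<close>
    have "((\<lambda>t. t * \<alpha> (t *\<^sub>R p) v) has_real_derivative F' 0 t) (at t within {0..1})" for t
    proof -
      have "((\<lambda>t. \<alpha> (t *\<^sub>R p) v) has_derivative (\<lambda>h. D v (t *\<^sub>R p) (h *\<^sub>R p))) (at t within {0..1})"
        by (rule has_derivative_compose[OF _ deriv]) (auto intro!: derivative_eq_intros)
      then have *: "((\<lambda>t. \<alpha> (t *\<^sub>R p) v) has_real_derivative D v (t *\<^sub>R p) p) (at t within {0..1})"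
        by (rule has_derivative_imp_has_field_derivative) (simp add: linear_cmul[OF D_lin])
      have "F' 0 t = \<alpha> (t *\<^sub>R p) v + t * D v (t *\<^sub>R p) p"
        unfolding closed[of v] expand[of _ v] D_expand[of p] F'_def
        by (simp add: sum.distrib sum_distrib_left algebra_simps)
      then show ?thesis
        by (auto intro!: derivative_eq_intros *)
    qed
    then have "(F' 0 has_integral (1 * \<alpha> (1 *\<^sub>R p) v - 0 * \<alpha> (0 *\<^sub>R p) v)) {0..1}"
      by (intro fundamental_theorem_of_calculus)
        (auto simp: has_real_derivative_iff_has_vector_derivative)
    then show ?thesis
      by (simp add: integral_unique cbox_interval)
  qed
  ultimately show "((\<lambda>s. integral (cbox 0 1) (\<lambda>t. \<alpha> (t *\<^sub>R (p + s *\<^sub>R v)) (p + s *\<^sub>R v)))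
      has_real_derivative \<alpha> p v) (at 0)"
    by (simp add: F_def)
qed

lemma mvt_along_segment:
  fixes f :: "'a::real_vector \<Rightarrow> real" and s :: real
  assumes "\<And>p v. ((\<lambda>s. f (p + s *\<^sub>R v)) has_real_derivative \<alpha> p v) (at 0)" and "s > 0"
  obtains t where "f (p + s *\<^sub>R v) - f p = s * \<alpha> (p + t *\<^sub>R v) v"
proof -
  have "((\<lambda>s. f (p + s *\<^sub>R v)) has_real_derivative \<alpha> (p + t *\<^sub>R v) v) (at t)" for t
  proof -
    \<comment> \<open>Rebasing the line at \<open>p + t *\<^sub>R v\<close> carries the hypothesis
      from parameter 0 to parameter t.\<close>
    have "((\<lambda>s. f ((p + t *\<^sub>R v) + s *\<^sub>R v)) has_real_derivative \<alpha> (p + t *\<^sub>R v) v) (at 0)"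
      by (rule assms(1))
    then show ?thesis
      using DERIV_shift[of "\<lambda>s. f (p + s *\<^sub>R v)" _ 0 t]
      by (simp add: algebra_simps)
  qed
  from MVT2[OF \<open>s > 0\<close> this] that show ?thesis
    by force
qed

section \<open>Left-invariant 2-forms and their explicit primitives\<close>

definition invariant_2form :: "real \<Rightarrow> real \<Rightarrow> real \<Rightarrow> real^3 \<Rightarrow> real^3 \<Rightarrow> real^3 \<Rightarrow> real" where
  "invariant_2form a b c p u v = a * wedge11 heis_f1 heis_f2 p u v
     + b * wedge11 heis_f1 heis_f3 p u v + c * wedge11 heis_f2 heis_f3 p u v"

text \<open>Translation by the inverse \<open>- p\<close> moves p to 0, and its differential sends a
  vector to its components in the left-invariant frame. So \<open>B\<close> is determined by an
  alternating form at 0, which has three coefficients.\<close>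

lemma left_invariant2_eq_invariant_2form:
  assumes inv: "left_invariant2 B"
    and bil: "\<And>p. bilinear (B p)" and alt: "\<And>p v. B p v v = 0"
  obtains a b c where "B = invariant_2form a b c"
proof
  let ?e = "\<lambda>i. axis i 1 :: real^3"
  have skew: "B 0 v u = - B 0 u v" for u v
    using alt[of 0 "u + v"] alt[of 0 u] alt[of 0 v]
    by (simp add: bilinear_ladd[OF bil] bilinear_radd[OF bil])
  have "w = w$1 *\<^sub>R ?e 1 + w$2 *\<^sub>R ?e 2 + w$3 *\<^sub>R ?e 3" for w
    by (simp add: vec_eq_iff forall_3 axis_def)
  then have expand: "B 0 u v = B 0 (u$1 *\<^sub>R ?e 1 + u$2 *\<^sub>R ?e 2 + u$3 *\<^sub>R ?e 3)
      (v$1 *\<^sub>R ?e 1 + v$2 *\<^sub>R ?e 2 + v$3 *\<^sub>R ?e 3)" for u v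
    by metis
  show "B = invariant_2form (B 0 (?e 1) (?e 2)) (B 0 (?e 1) (?e 3)) (B 0 (?e 2) (?e 3))"
  proof (intro ext)
    fix p u v
    let ?T = "\<lambda>w. vector [heis_f1 p w, heis_f2 p w, heis_f3 p w] :: real^3"
    have "B p u v = pull_back2 (heis_mult (- p)) B p u v"
      using inv by (simp add: left_invariant2_def)
    also have "\<dots> = B 0 (?T u) (?T v)"
    proof -
      have "heis_mult (- p) p = 0"
        by (simp add: vec_eq_iff forall_3)
      moreover have "frechet_derivative (heis_mult (- p)) (at p) w = ?T w" for w
        by (simp add: frechet_derivative_heis_mult heis_f1_def heis_f2_def heis_f3_def
            vec_eq_iff forall_3 algebra_simps)
      ultimately show ?thesis
        by (simp add: pull_back2_def)
    qed
    also have "\<dots> = invariant_2form (B 0 (?e 1) (?e 2)) (B 0 (?e 1) (?e 3)) (B 0 (?e 2) (?e 3)) p u v"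
      by (subst expand) (simp add: bilinear_ladd[OF bil] bilinear_radd[OF bil] bilinear_lmul[OF bil]
          bilinear_rmul[OF bil] alt skew[of "?e 2" "?e 1"] skew[of "?e 3" "?e 1"]
          skew[of "?e 3" "?e 2"] invariant_2form_def wedge11_def algebra_simps)
    finally show "B p u v = \<dots>" .
  qed
qed

text \<open>Not left-invariant unless \<open>b = c = 0\<close>.\<close>

definition primitive_2form :: "real \<Rightarrow> real \<Rightarrow> real \<Rightarrow> real^3 \<Rightarrow> real^3 \<Rightarrow> real" where
  "primitive_2form a b c p v = - a * heis_f3 p v
     + b * (p$1 * v$3 - (p$1)\<^sup>2 / 4 * v$2) + c * (p$2 * v$3 + (p$2)\<^sup>2 / 4 * v$1)"

lemma primitive_2form_has_derivative:
  "((\<lambda>q. primitive_2form a b c q v) has_derivative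
     (\<lambda>u. a / 2 * (u$1 * v$2 - u$2 * v$1) + b * (u$1 * v$3 - p$1 * u$1 / 2 * v$2)
        + c * (u$2 * v$3 + p$2 * u$2 / 2 * v$1))) (at p)"
proof -
  have nth: "((\<lambda>q::real^3. q $ i) has_derivative (\<lambda>u. u $ i)) (at p)" for i
    by (rule bounded_linear_imp_has_derivative[OF bounded_linear_vec_nth])
  show ?thesis
    unfolding primitive_2form_def heis_f3_def
    by (auto intro!: derivative_eq_intros nth simp: fun_eq_iff field_simps)
qed

text \<open>Termwise: d e^3 = - e^1 \<and> e^2; e^1 \<and> e^3 = dx \<and> dz - (x/2) dx \<and> dy =
  d(x dz - (x^2/4) dy); e^2 \<and> e^3 = dy \<and> dz + (y/2) dy \<and> dx = d(y dz + (y^2/4)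
  dx).\<close>

lemma ext_d1_primitive_2form:
  "ext_d1 (primitive_2form a b c) = invariant_2form a b c"
  unfolding ext_d1_def fun_eq_iff
  by (simp add: frechet_derivative_at[OF primitive_2form_has_derivative, symmetric]
      invariant_2form_def wedge11_def heis_f1_def heis_f2_def heis_f3_def field_simps)

section \<open>Smoothness of multiples of e^3 and dual norms for the canonical metric\<close>

lemma C_k_const: "C_k k (\<lambda>x. c)"
  by (induction k arbitrary: c) (auto simp: frechet_derivative_const)

text \<open>The first derivative does not depend on the base point, so all higher ones are those of
  a constant. Applied to e^3, whose value on a fixed vector is affine in p.\<close>

lemma C_infinity_affine:
  assumes "bounded_linear f"
  shows "C_infinity (\<lambda>x. c + f x)"
proof -
  have deriv: "((\<lambda>x. c + f x) has_derivative f) (at x)" for x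
    using has_derivative_add[OF has_derivative_const bounded_linear_imp_has_derivative[OF assms]]
    by simp
  have "C_k k (\<lambda>x. c + f x)" for k
  proof (cases k)
    case 0
    then show ?thesis
      using assms by (simp add: continuous_on_add linear_continuous_on)
  next
    case (Suc m)
    have "(\<lambda>x. c + f x) differentiable (at x)" for x
      using deriv by (auto simp: differentiable_def)
    then show ?thesis
      by (simp add: Suc C_k_const frechet_derivative_at[OF deriv, symmetric])
  qed
  then show ?thesis
    by (simp add: C_infinity_def)
qed

lemma smooth_1form_mult_heis_f3: "smooth_1form (\<lambda>p v. r * heis_f3 p v)"
proof -
  have "linear (\<lambda>v. r * heis_f3 p v)" for p
    by (rule linearI) (simp_all add: heis_f3_def algebra_simps)
  moreover have "C_infinity (\<lambda>p. r * heis_f3 p v)" for v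
  proof -
    have "linear (\<lambda>p::real^3. r * (p$2 * v$1 - p$1 * v$2) / 2)"
      by (rule linearI) (simp_all add: field_simps)
    from C_infinity_affine[OF this[unfolded linear_conv_bounded_linear], of "r * v$3"]
    show ?thesis
      by (simp add: heis_f3_def field_simps)
  qed
  ultimately show ?thesis
    by (simp add: smooth_1form_def)
qed

text \<open>Makes the real \<open>Sup\<close> in \<open>dual_norm\<close> an actual upper bound. The
  frame is orthonormal, so each frame component of v is at most 1 in absolute value.\<close>

lemma bdd_above_dual_norm_heis_metric:
  fixes \<alpha> :: "real^3 \<Rightarrow> real"
  assumes "linear \<alpha>"
  shows "bdd_above {\<bar>\<alpha> v\<bar> | v. heis_metric p v v \<le> 1}"
proof (rule bdd_aboveI)
  let ?C = "\<bar>\<alpha> (heis_e1 p)\<bar> + \<bar>\<alpha> (heis_e2 p)\<bar> + \<bar>\<alpha> (heis_e3 p)\<bar>"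
  fix r assume "r \<in> {\<bar>\<alpha> v\<bar> | v. heis_metric p v v \<le> 1}"
  then obtain v where r: "r = \<bar>\<alpha> v\<bar>" and v: "heis_metric p v v \<le> 1"
    by blast
  have "v = heis_f1 p v *\<^sub>R heis_e1 p + heis_f2 p v *\<^sub>R heis_e2 p + heis_f3 p v *\<^sub>R heis_e3 p"
    by (simp add: vec_eq_iff forall_3 heis_f1_def heis_f2_def heis_f3_def
        heis_e1_def heis_e2_def heis_e3_def algebra_simps)
  then have "\<alpha> v = heis_f1 p v * \<alpha> (heis_e1 p) + heis_f2 p v * \<alpha> (heis_e2 p)
      + heis_f3 p v * \<alpha> (heis_e3 p)"
    by (metis linear_add[OF assms] linear_cmul[OF assms] real_scaleR_def)
  moreover have "(heis_f1 p v)\<^sup>2 \<le> 1" "(heis_f2 p v)\<^sup>2 \<le> 1" "(heis_f3 p v)\<^sup>2 \<le> 1"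
    using v by (simp_all add: heis_metric_def flip: power2_eq_square)
      (smt (verit) zero_le_power2)+
  then have "\<bar>heis_f1 p v * x\<bar> \<le> \<bar>x\<bar>" "\<bar>heis_f2 p v * x\<bar> \<le> \<bar>x\<bar>" "\<bar>heis_f3 p v * x\<bar> \<le> \<bar>x\<bar>" for x
    by (simp_all add: abs_mult mult_left_le_one_le abs_square_le_1)
  ultimately show "r \<le> ?C"
    unfolding r by (smt (verit))
qed

lemma dual_norm_heis_metric_upper:
  fixes \<alpha> :: "real^3 \<Rightarrow> real"
  assumes "linear \<alpha>" "heis_metric p v v \<le> 1"
  shows "\<bar>\<alpha> v\<bar> \<le> dual_norm (heis_metric p) \<alpha>"
  unfolding dual_norm_def
  by (rule cSup_upper[OF _ bdd_above_dual_norm_heis_metric[OF assms(1)]]) (use assms(2) in blast)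

text \<open>The supremum is attained at \<open>heis_e3 p\<close>. It is the same at every p.\<close>

lemma dual_norm_mult_heis_f3: "dual_norm (heis_metric p) (\<lambda>v. r * heis_f3 p v) = \<bar>r\<bar>"
  unfolding dual_norm_def
proof (rule cSup_eq_maximum)
  show "\<bar>r\<bar> \<in> {\<bar>r * heis_f3 p v\<bar> | v. heis_metric p v v \<le> 1}"
    using heis_metric_orthonormal(6)[of p] heis_dual_basis(9)[of p]
    by (metis (mono_tags, lifting) mem_Collect_eq mult.right_neutral order_refl)
next
  fix x assume "x \<in> {\<bar>r * heis_f3 p v\<bar> | v. heis_metric p v v \<le> 1}"
  then obtain v where x: "x = \<bar>r * heis_f3 p v\<bar>" and v: "heis_metric p v v \<le> 1"
    by blast
  have "(heis_f3 p v)\<^sup>2 \<le> 1"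
    using v by (simp add: heis_metric_def flip: power2_eq_square) (smt (verit) zero_le_power2)
  then show "x \<le> \<bar>r\<bar>"
    by (simp add: x abs_mult mult_left_le abs_square_le_1)
qed

section \<open>Flux estimates for large loops\<close>

text \<open>Divide by s and let s tend to infinity; this is how growing loops absorb a fixed error
  z.\<close>

lemma scaled_bound_imp_le:
  fixes x :: real
  assumes "\<And>s. s > 0 \<Longrightarrow> x * s \<le> y * s + z"
  shows "x \<le> y"
proof (rule ccontr)
  assume "\<not> x \<le> y"
  then have d: "x - y > 0" by simp
  \<comment> \<open>Chosen so that \<open>(x - y) * ?s\<close> is \<open>\<bar>z\<bar> + 1\<close>,
    which exceeds z.\<close>
  let ?s = "(\<bar>z\<bar> + 1) / (x - y)"
  have "?s > 0" using d by (simp add: add_nonneg_pos)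
  from assms[OF this] have "(x - y) * ?s \<le> z" by (simp only: left_diff_distrib)
  with d show False by simp
qed

lemma vector3_arith:
  fixes x y z u v w s :: real
  shows "vector [x, y, z] + vector [u, v, w] = (vector [x + u, y + v, z + w] :: real^3)"
    and "s *\<^sub>R vector [u, v, w] = (vector [s * u, s * v, s * w] :: real^3)"
  by (simp_all add: vec_eq_iff forall_3)

lemma bounded_primitive_bounds:
  assumes \<theta>: "smooth_1form \<theta>" and d\<theta>: "ext_d1 \<theta> = invariant_2form a b c"
    and bound: "\<And>p v. heis_metric p v v \<le> 1 \<Longrightarrow> \<bar>\<theta> p v\<bar> \<le> C"
  shows "b = 0" "c = 0" "\<bar>a\<bar> \<le> C"
proof -
  let ?\<eta> = "primitive_2form a b c"
  let ?d = "\<lambda>v p. frechet_derivative (\<lambda>q. \<theta> q v) (at p)"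
  let ?d\<eta> = "\<lambda>v p u. a / 2 * (u$1 * v$2 - u$2 * v$1) + b * (u$1 * v$3 - p$1 * u$1 / 2 * v$2)
      + c * (u$2 * v$3 + p$2 * u$2 / 2 * v$1)"
  have lin: "linear (\<lambda>v. \<theta> p v - ?\<eta> p v)" for p
  proof -
    have "linear (?\<eta> p)"
      by (rule linearI) (simp_all add: primitive_2form_def heis_f3_def algebra_simps
          add_divide_distrib diff_divide_distrib)
    with \<theta> show ?thesis
      by (auto simp: smooth_1form_def intro: linear_compose_sub)
  qed
  have C1: "C_k (Suc 0) (\<lambda>q. \<theta> q v)" for v
    using \<theta> unfolding smooth_1form_def C_infinity_def by blast
  have deriv: "((\<lambda>q. \<theta> q v - ?\<eta> q v) has_derivative (\<lambda>u. ?d v p u - ?d\<eta> v p u)) (at p)" for v p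
    using C1 by (intro has_derivative_diff primitive_2form_has_derivative)
      (simp add: flip: frechet_derivative_works)
  have cont: "continuous_on UNIV (\<lambda>p. ?d v p u - ?d\<eta> v p u)" for u v
    using C1[of v] by (auto intro!: continuous_intros)
  have closed: "?d v p u - ?d\<eta> v p u = ?d u p v - ?d\<eta> u p v" for p u v
  proof -
    have "ext_d1 \<theta> p u v = ext_d1 ?\<eta> p u v"
      by (simp add: d\<theta> ext_d1_primitive_2form)
    then show ?thesis
      by (simp add: ext_d1_def frechet_derivative_at[OF primitive_2form_has_derivative, symmetric])
  qed
  obtain f where f: "((\<lambda>s. f (p + s *\<^sub>R v)) has_real_derivative \<theta> p v - ?\<eta> p v) (at 0)" for p v
    using closed_1form_potential[OF lin deriv cont closed] by blast
  note mvt = mvt_along_segment[of f "\<lambda>p v. \<theta> p v - ?\<eta> p v", OF f]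
  \<comment> \<open>Here r is the value of \<theta> at the mean value point. On every segment used
    below, \<eta> along the direction of travel is independent of t, so the unknown point drops
    out.\<close>
  have step: "\<exists>r t. \<bar>r\<bar> \<le> C \<and> f (p + s *\<^sub>R v) - f p = s * (r - ?\<eta> (p + t *\<^sub>R v) v)"
    if "s > 0" "\<And>t. heis_metric (p + t *\<^sub>R v) v v \<le> 1" for s p v
    using mvt[OF that(1)] bound[OF that(2)] by metis
  note simps = heis_metric_def heis_f1_def heis_f2_def heis_f3_def primitive_2form_def
  \<comment> \<open>Both squares at once: (x, y) selects e_1 or e_2, and the corners are 0, (sx, sy,
    0), (sx, sy, s), (0, 0, s). The contributions of a on the two vertical sides cancel, leaving the
    flux \<open>\<beta> * s * s\<close>; one factor s is divided out.\<close>
  have flat: "b * x + c * y = 0" if xy: "x = 1 \<and> y = 0 \<or> x = 0 \<and> y = 1" for x y :: real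
  proof -
    define \<beta> where "\<beta> = b * x + c * y"
    have "\<bar>\<beta>\<bar> * s \<le> 0 * s + 4 * C" if s: "s > 0" for s
    proof -
      obtain r1 where r1: "\<bar>r1\<bar> \<le> C" "f (vector [s * x, s * y, 0]) - f 0 = s * r1"
        using step[of s 0 "vector [x, y, 0]"] s xy
        by (auto simp: simps vector3_arith)
      obtain r2 where r2: "\<bar>r2\<bar> \<le> C" "f (vector [s * x, s * y, s])
          - f (vector [s * x, s * y, 0]) = s * (r2 - (\<beta> * s - a))"
        using step[of s "vector [s * x, s * y, 0]" "vector [0, 0, 1]"] s xy
        by (auto simp: simps vector3_arith \<beta>_def)
      obtain r3 where r3: "\<bar>r3\<bar> \<le> C"
        "f (vector [s * x, s * y, s]) - f (vector [0, 0, s]) = s * r3"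
        using step[of s "vector [0, 0, s]" "vector [x, y, 0]"] s xy
        by (auto simp: simps vector3_arith)
      obtain r4 where r4: "\<bar>r4\<bar> \<le> C" "f (vector [0, 0, s]) - f 0 = s * (r4 + a)"
        using step[of s 0 "vector [0, 0, 1]"] s
        by (auto simp: simps vector3_arith)
      have "s * (r1 + (r2 - (\<beta> * s - a)) - r3 - (r4 + a)) = 0"
        using r1(2) r2(2) r3(2) r4(2) by (simp add: algebra_simps)
      then have "r1 + (r2 - (\<beta> * s - a)) - r3 - (r4 + a) = 0" using s by simp
      then have "\<beta> * s = r1 + r2 - r3 - r4" by linarith
      then have "\<bar>\<beta> * s\<bar> \<le> 4 * C" using r1(1) r2(1) r3(1) r4(1) by linarith
      then show ?thesis using s by (simp add: abs_mult)
    qed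
    then show ?thesis using scaled_bound_imp_le[of "\<bar>\<beta>\<bar>" 0 "4 * C"] by (simp add: \<beta>_def)
  qed
  show b: "b = 0" using flat[of 1 0] by simp
  show c: "c = 0" using flat[of 0 1] by simp
  have "\<bar>a\<bar> * s \<le> C * s + 4 * C" if s: "s > 0" for s
  proof -
    obtain r1 where r1: "\<bar>r1\<bar> \<le> C" "f (vector [s, 0, 0]) - f 0 = s * r1"
      using step[of s 0 "vector [1, 0, 0]"] s
      by (auto simp: simps vector3_arith b c)
    \<comment> \<open>The direction is e_2 on the line x = s; in the next segment, e_1 on the line y
      = s. These sides are horizontal, so \<eta> = -a e^3 vanishes along them. The segments of
      \<open>r3\<close>, \<open>r4\<close> and \<open>r5\<close> are traversed backwards in the
      loop.\<close>
    obtain r2 where r2: "\<bar>r2\<bar> \<le> C"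
      "f (vector [s, s, s * s / 2]) - f (vector [s, 0, 0]) = s * r2"
      using step[of s "vector [s, 0, 0]" "vector [0, 1, s / 2]"] s
      by (auto simp: simps vector3_arith b c)
    obtain r3 where r3: "\<bar>r3\<bar> \<le> C"
      "f (vector [s, s, s * s / 2]) - f (vector [0, s, s * s]) = s * r3"
      using step[of s "vector [0, s, s * s]" "vector [1, 0, - s / 2]"] s
      by (auto simp: simps vector3_arith b c)
    obtain r4 where r4: "\<bar>r4\<bar> \<le> C"
      "f (vector [0, s, s * s]) - f (vector [0, 0, s * s]) = s * r4"
      using step[of s "vector [0, 0, s * s]" "vector [0, 1, 0]"] s
      by (auto simp: simps vector3_arith b c)
    obtain r5 where r5: "\<bar>r5\<bar> \<le> C" "f (vector [0, 0, s * s]) - f 0 = s * s * (r5 + a)"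
      using step[of "s * s" 0 "vector [0, 0, 1]"] s
      by (auto simp: simps vector3_arith b c)
    \<comment> \<open>The closing vertical segment has length \<open>s * s\<close>, so after
      division by s the terms with a and \<open>r5\<close> still grow with s, while the four
      horizontal sides contribute at most 4C.\<close>
    have "s * (r1 + r2 - r3 - r4 - s * (r5 + a)) = 0"
      using r1(2) r2(2) r3(2) r4(2) r5(2) by (simp add: algebra_simps)
    then have "r1 + r2 - r3 - r4 - s * (r5 + a) = 0" using s by simp
    then have "s * a = r1 + r2 - r3 - r4 - s * r5" by (simp add: algebra_simps)
    moreover have "\<bar>s * r5\<bar> \<le> C * s"
      using s r5(1) by (simp add: abs_mult)
    ultimately have "\<bar>s * a\<bar> \<le> C * s + 4 * C" using r1(1) r2(1) r3(1) r4(1) by linarith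
    then show ?thesis using s by (simp add: abs_mult mult.commute)
  qed
  then show "\<bar>a\<bar> \<le> C" by (rule scaled_bound_imp_le)
qed

section \<open>The critical value as an infimum over primitives\<close>

theorem proposition5p1:
  fixes \<Lambda> :: "(real^3) set" and \<omega> :: "nil_tangent \<Rightarrow> nil_tangent \<Rightarrow> real"
  assumes "heis_lattice \<Lambda>"
    and "invariant_magnetic_field \<Lambda> \<omega>"
  shows "(mane_critical_value \<Lambda> (nil_metric \<Lambda>) \<omega> < \<infinity> \<longleftrightarrow>
            (\<exists>\<rho>::real. lift2 \<Lambda> \<omega> = (\<lambda>p u v. \<rho> * wedge11 heis_f1 heis_f2 p u v))) \<and>
         (\<forall>\<rho>::real. lift2 \<Lambda> \<omega> = (\<lambda>p u v. \<rho> * wedge11 heis_f1 heis_f2 p u v) \<longrightarrow>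
            (\<exists>\<theta>. smooth_1form \<theta> \<and> left_invariant1 \<theta> \<and> ext_d1 \<theta> = lift2 \<Lambda> \<omega>) \<and>
            mane_critical_value \<Lambda> (nil_metric \<Lambda>) \<omega> = ereal (\<rho>\<^sup>2 / 2))"
proof -
  let ?mane = "mane_critical_value \<Lambda> (nil_metric \<Lambda>) \<omega>"
  define E where "E = (\<lambda>\<theta>. SUP p. ereal ((1/2) * (dual_norm (heis_metric p) (\<theta> p))\<^sup>2))"
  have "lift2 \<Lambda> (nil_metric \<Lambda>) = heis_metric"
    unfolding nil_metric_def using assms(1) left_invariant_heis_metric
    by (intro lift2_descend2) (auto simp: heis_lattice_def left_invariant2_def)
  then have mane: "?mane = (INF \<theta>\<in>{\<theta>. smooth_1form \<theta> \<and> ext_d1 \<theta> = lift2 \<Lambda> \<omega>}. E \<theta>)"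
    by (simp add: mane_critical_value_def E_def)
  obtain a b c where abc: "lift2 \<Lambda> \<omega> = invariant_2form a b c"
    using assms(2) left_invariant2_eq_invariant_2form
    unfolding invariant_magnetic_field_def magnetic_field_def smooth_2form_def by metis
  \<comment> \<open>Stated for arbitrary coefficients because it is used twice: with a, b, c to
    force b = c = 0, and with \<rho>, 0, 0 for the lower bound on the critical value.\<close>
  have bounds: "b' = 0 \<and> c' = 0 \<and> ereal (a'\<^sup>2 / 2) \<le> E \<theta>"
    if \<theta>: "smooth_1form \<theta>" "ext_d1 \<theta> = invariant_2form a' b' c'" and fin: "E \<theta> < \<infinity>" for a' b' c' \<theta>
  proof -
    have le: "ereal ((1/2) * (dual_norm (heis_metric p) (\<theta> p))\<^sup>2) \<le> E \<theta>" for p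
      unfolding E_def by (rule SUP_upper) simp
    \<comment> \<open>Excludes minus infinity, so a finite \<open>E \<theta>\<close> is a real K;
      then \<open>\<bar>\<theta>\<bar>\<^sup>2 / 2 \<le> K\<close> gives the pointwise bound
      \<open>sqrt (2 * K)\<close>.\<close>
    have "0 \<le> E \<theta>"
      by (rule order_trans[OF _ le[of 0]]) simp
    with fin obtain K where K: "E \<theta> = ereal K" "K \<ge> 0"
      by (cases "E \<theta>") auto
    have "\<bar>\<theta> p v\<bar> \<le> sqrt (2 * K)" if "heis_metric p v v \<le> 1" for p v
    proof -
      have "\<bar>\<theta> p v\<bar> \<le> dual_norm (heis_metric p) (\<theta> p)"
        using \<theta>(1) that by (intro dual_norm_heis_metric_upper) (simp_all add: smooth_1form_def)
      moreover have "dual_norm (heis_metric p) (\<theta> p) \<le> sqrt (2 * K)"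
        using le[of p] K by (intro real_le_rsqrt) simp
      ultimately show ?thesis
        by simp
    qed
    from bounded_primitive_bounds[OF \<theta> this] have "b' = 0" "c' = 0" "\<bar>a'\<bar> \<le> sqrt (2 * K)"
      by auto
    moreover from this(3) have "a'\<^sup>2 \<le> 2 * K"
      using sqrt_ge_absD by blast
    ultimately show ?thesis
      by (simp add: K)
  qed
  have value_of_exact: "(\<exists>\<theta>. smooth_1form \<theta> \<and> left_invariant1 \<theta> \<and> ext_d1 \<theta> = lift2 \<Lambda> \<omega>) \<and>
      ?mane = ereal (\<rho>\<^sup>2 / 2)"
    if "lift2 \<Lambda> \<omega> = (\<lambda>p u v. \<rho> * wedge11 heis_f1 heis_f2 p u v)" for \<rho>
  proof -
    have \<omega>: "lift2 \<Lambda> \<omega> = invariant_2form \<rho> 0 0"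
      by (simp add: that invariant_2form_def fun_eq_iff)
    \<comment> \<open>The left-invariant primitive has constant norm
      \<open>\<bar>\<rho>\<bar>\<close> and so realises the infimum.\<close>
    let ?\<theta> = "\<lambda>p v. - \<rho> * heis_f3 p v"
    have "?\<theta> = primitive_2form \<rho> 0 0"
      by (simp add: primitive_2form_def fun_eq_iff)
    with smooth_1form_mult_heis_f3[of "- \<rho>"] have \<theta>: "smooth_1form ?\<theta>" "ext_d1 ?\<theta> = lift2 \<Lambda> \<omega>"
      by (simp_all add: ext_d1_primitive_2form \<omega>)
    have "left_invariant1 ?\<theta>"
      using left_invariant_coframe(3) by (simp add: left_invariant1_def pull_back1_def fun_eq_iff)
    moreover have "E ?\<theta> = ereal (\<rho>\<^sup>2 / 2)"
      unfolding E_def dual_norm_mult_heis_f3 by simp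
    then have "?mane \<le> ereal (\<rho>\<^sup>2 / 2)"
      unfolding mane using \<theta> by (metis (mono_tags, lifting) INF_lower mem_Collect_eq)
    moreover have "ereal (\<rho>\<^sup>2 / 2) \<le> ?mane"
      unfolding mane
    proof (rule INF_greatest)
      fix \<theta> assume "\<theta> \<in> {\<theta>. smooth_1form \<theta> \<and> ext_d1 \<theta> = lift2 \<Lambda> \<omega>}"
      then show "ereal (\<rho>\<^sup>2 / 2) \<le> E \<theta>"
        \<comment> \<open>A primitive with infinite \<open>E \<theta>\<close> satisfies the
          inequality trivially.\<close>
        using bounds[of \<theta> \<rho> 0 0] \<omega> by (cases "E \<theta> < \<infinity>") auto
    qed
    ultimately show ?thesis
      using \<theta> by auto
  qed
  have exact_if_finite: "\<exists>\<rho>. lift2 \<Lambda> \<omega> = (\<lambda>p u v. \<rho> * wedge11 heis_f1 heis_f2 p u v)" if "?mane < \<infinity>"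
  proof -
    \<comment> \<open>An infimum below infinity provides one primitive of finite \<open>E\<close>,
      which already forces b = c = 0.\<close>
    from that obtain \<theta> where "smooth_1form \<theta>" "ext_d1 \<theta> = invariant_2form a b c" "E \<theta> < \<infinity>"
      unfolding mane abc INF_less_iff by blast
    from bounds[OF this] show ?thesis
      by (auto simp: abc invariant_2form_def fun_eq_iff)
  qed
  show ?thesis
  proof (intro conjI iffI allI impI)
    assume "?mane < \<infinity>"
    then show "\<exists>\<rho>. lift2 \<Lambda> \<omega> = (\<lambda>p u v. \<rho> * wedge11 heis_f1 heis_f2 p u v)"
      by (rule exact_if_finite)
  next
    assume "\<exists>\<rho>. lift2 \<Lambda> \<omega> = (\<lambda>p u v. \<rho> * wedge11 heis_f1 heis_f2 p u v)"
    then show "?mane < \<infinity>"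
      using value_of_exact by force
  qed (use value_of_exact in blast)+
qed

end
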